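(* Let $1<p<2$ and $\alpha=\mu+i\nu\in\mathbb{C}\setminus\mathbb{Z}$ with $\mu,\nu\in\mathbb{R}$. Then for all complex-valued $u\in C_c^\infty(\mathbb{R}^2)$, $$\int_{\mathbb{R}^2}|\nabla_{A_\infty}u|^p\,dx\ \ge\ \left[\left(\frac{2-p}{p}\right)^2+\left(\frac{|\nu|}{\sinh(\pi|\nu|)}\right)^2\bigl(\sin^2(\pi\mu)+\sinh^2(\pi\nu)\bigr)\right]^{p/2}\int_{\mathbb{R}^2}\frac{|u|^p}{|x|^p}\,dx,$$ where for $\nu=0$ the quotient $|\nu|/\sinh(\pi|\nu|)$ is understood as its limit value $1/\pi$.
   Context: The complex Aharonov--Bohm potential with parameter $\alpha\in\mathbb{C}$ is $A_\infty(x)=(-x_2,x_1)\,\dfrac{\alpha}{|x|^2}$ for $x=(x_1,x_2)\in\mathbb{R}^2\setminus\{0\}$ (a $\mathbb{C}^2$-valued field). The magnetic gradient of a complex-valued function $u$ is $\nabla_{A_\infty}u:=\nabla u-iA_\infty u$, and $|\nabla_{A_\infty}u|$ is its Euclidean (Hermitian) norm in $\mathbb{C}^2$. *)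

theory Defs
  imports "HOL-Analysis.Analysis"
begin

definition partial_deriv :: "'n::finite \<Rightarrow> (real^'n \<Rightarrow> 'b::real_normed_vector) \<Rightarrow> real^'n \<Rightarrow> 'b" where
  "partial_deriv j f x = frechet_derivative f (at x) (axis j 1)"

primrec Ck :: "nat \<Rightarrow> (real^'n::finite \<Rightarrow> 'b::real_normed_vector) \<Rightarrow> bool" where
  "Ck 0 f \<longleftrightarrow> continuous_on UNIV f"
| "Ck (Suc k) f \<longleftrightarrow> f differentiable_on UNIV \<and> (\<forall>j. Ck k (partial_deriv j f))"

definition Cc_infinity :: "(real^'n::finite \<Rightarrow> 'b::real_normed_vector) set" where
  "Cc_infinity = {f. (\<forall>k. Ck k f) \<and> compact (closure {x. f x \<noteq> 0})}"

text \<open>At the singularity \<open>x = 0\<close>, a null set, the potential takes the value \<open>0\<close>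
  because division by zero yields zero.\<close>

definition AB_potential :: "complex \<Rightarrow> real^2 \<Rightarrow> complex^2" where
  "AB_potential \<alpha> x = (\<alpha> / of_real ((norm x)\<^sup>2)) *s vector [of_real (- x $ 2), of_real (x $ 1)]"

text \<open>The norm on \<open>complex^2\<close> is the Hermitian one.\<close>

definition magnetic_grad :: "(real^2 \<Rightarrow> complex^2) \<Rightarrow> (real^2 \<Rightarrow> complex) \<Rightarrow> real^2 \<Rightarrow> complex^2" where
  "magnetic_grad A u x = (\<chi> j. partial_deriv j u x) - (\<i> * u x) *s A x"

definition sinh_quotient :: "real \<Rightarrow> real" where
  "sinh_quotient \<nu> = (if \<nu> = 0 then 1 / pi else \<bar>\<nu>\<bar> / sinh (pi * \<bar>\<nu>\<bar>))"

end

theory Submission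
  imports Defs
begin

text \<open>
  Both components of the magnetic gradient are handled by Minkowski's integral inequality along a
  one-parameter group of linear maps, so polar coordinates are never needed. Integrating \<open>u\<close>
  along dilations gives \<open>|u(x)|/|x| \<le> \<integral>\<^sub>1\<^sup>\<infinity> |\<partial>\<^sub>r u|(s x) ds\<close>, and \<open>L\<^sup>p\<close> norms scale by
  \<open>s\<close> to the power \<open>-2/p\<close>, which yields the Hardy constant \<open>(2 - p)/p\<close>.
  Integrating \<open>exp (- i \<alpha> t) u\<close> over a full rotation gives
  \<open>|exp (- 2 \<pi> i \<alpha>) - 1| |u(x)| \<le> \<integral> exp (\<nu> t) |(\<partial>\<^sub>\<theta> - i \<alpha>) u|(rot t x) dt\<close> over \<open>0 \<le> t \<le> 2 \<pi>\<close>,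
  and rotations preserve \<open>L\<^sup>p\<close> norms, which yields the constant with the hyperbolic sine. Finally
  concavity of \<open>s \<mapsto> s\<close> to the power \<open>p/2\<close> combines the two estimates: with constants \<open>A\<close> and \<open>K\<close>
  the optimal weights are \<open>A\<^sup>2/(A\<^sup>2 + K\<^sup>2)\<close> and \<open>K\<^sup>2/(A\<^sup>2 + K\<^sup>2)\<close>.
\<close>

section \<open>Young, Jensen and Minkowski inequalities for nonnegative integrals\<close>

lemma weighted_powr_mult_le:
  fixes a b x y :: real
  assumes "0 \<le> a" "0 \<le> b" "a + b = 1" "0 \<le> x" "0 \<le> y"
  shows "x powr a * y powr b \<le> a * x + b * y"
  using assms Youngs_inequality_0[of a b x y] by (cases "x = 0 \<or> y = 0") auto

text \<open>Convexity: the tangent to \<open>k powr p\<close> at \<open>k = c\<close> lies below the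
  graph. It is Young's inequality with weights \<open>1/p\<close> and
  \<open>(p - 1)/p\<close>.\<close>

lemma powr_tangent_le:
  fixes c k p :: real
  assumes "1 < p" "0 \<le> c" "0 \<le> k"
  shows "p * c powr (p - 1) * k \<le> k powr p + (p - 1) * c powr p"
proof -
  have "(k powr p) powr (1/p) * (c powr p) powr ((p - 1)/p)
      \<le> 1/p * (k powr p) + (p - 1)/p * (c powr p)"
    using assms by (intro weighted_powr_mult_le) (auto simp: field_simps)
  then have "k * c powr (p - 1) \<le> (k powr p + (p - 1) * c powr p) / p"
    using assms by (simp add: powr_powr add_divide_distrib)
  then show ?thesis
    using assms by (simp add: field_simps)
qed

text \<open>Jensen's inequality for the probability density \<open>b / B\<close>, with
  \<open>v / B\<close> a lower bound for the mean of \<open>k\<close>. Integrating the tangent bound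
  at that point works in \<open>ennreal\<close> even when the right-hand integral is
  infinite.\<close>

lemma nn_integral_powr_Jensen:
  fixes b k :: "'t \<Rightarrow> real"
  assumes p: "1 < p" and B: "0 < B" and v: "0 \<le> v"
    and [measurable]: "b \<in> borel_measurable N" "k \<in> borel_measurable N"
    and b: "\<And>t. 0 \<le> b t" and k: "\<And>t. 0 \<le> k t"
    and bB: "(\<integral>\<^sup>+t. ennreal (b t) \<partial>N) = ennreal B"
    and vle: "ennreal v \<le> (\<integral>\<^sup>+t. ennreal (b t * k t) \<partial>N)"
  shows "ennreal (v powr p) \<le> ennreal (B powr (p - 1)) * (\<integral>\<^sup>+t. ennreal (b t * k t powr p) \<partial>N)"
proof -
  define c where "c = v / B"
  have c: "0 \<le> c" using B v by (simp add: c_def)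
  let ?I = "\<integral>\<^sup>+t. ennreal (b t * k t powr p) \<partial>N"
  have "ennreal (p * c powr (p - 1) * v) = ennreal (p * c powr (p - 1)) * ennreal v"
    using p by (simp add: ennreal_mult v)
  also have "\<dots> \<le> ennreal (p * c powr (p - 1)) * (\<integral>\<^sup>+t. ennreal (b t * k t) \<partial>N)"
    by (rule mult_left_mono[OF vle]) simp
  also have "\<dots> = (\<integral>\<^sup>+t. ennreal (p * c powr (p - 1)) * ennreal (b t * k t) \<partial>N)"
    by (rule nn_integral_cmult[symmetric]) measurable
  also have "\<dots> \<le> (\<integral>\<^sup>+t. ennreal (b t * k t powr p) + ennreal ((p - 1) * c powr p) * ennreal (b t) \<partial>N)"
  proof (rule nn_integral_mono)
    fix t
    have "b t * (p * c powr (p - 1) * k t) \<le> b t * (k t powr p + (p - 1) * c powr p)"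
      by (intro mult_left_mono powr_tangent_le p c k b)
    then have "p * c powr (p - 1) * (b t * k t) \<le> b t * k t powr p + (p - 1) * c powr p * b t"
      by (simp add: algebra_simps)
    then show "ennreal (p * c powr (p - 1)) * ennreal (b t * k t)
        \<le> ennreal (b t * k t powr p) + ennreal ((p - 1) * c powr p) * ennreal (b t)"
      using p b k by (simp add: ennreal_mult[symmetric] ennreal_plus[symmetric] ennreal_leI del: ennreal_plus)
  qed
  also have "\<dots> = ?I + ennreal ((p - 1) * c powr p) * ennreal B"
    by (simp add: nn_integral_add nn_integral_cmult bB)
  also have "\<dots> = ?I + ennreal ((p - 1) * c powr p * B)"
    using p B by (simp add: ennreal_mult)
  finally have le: "ennreal (p * c powr (p - 1) * v) \<le> ?I + ennreal ((p - 1) * c powr p * B)" .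
  \<comment> \<open>Since \<open>v = c * B\<close>, the linear term equals \<open>p\<close> copies
    of \<open>c powr p * B\<close>. The finite \<open>p - 1\<close> copies on the right cancel, and
    the one that remains is \<open>v powr p\<close> divided by
    \<open>B powr (p - 1)\<close>.\<close>
  have cp: "c powr (p - 1) * v = c powr p * B"
    using B v by (cases "v = 0") (auto simp: c_def powr_diff)
  have "ennreal (p * c powr (p - 1) * v) = ennreal (c powr p * B) + ennreal ((p - 1) * c powr p * B)"
    using p B unfolding mult.assoc cp
    by (subst ennreal_plus[symmetric]) (auto simp: left_diff_distrib mult_le_cancel_right1 not_less)
  with le have "ennreal (c powr p * B) \<le> ?I"
    by (simp add: ennreal_add_left_cancel_le add.commute)
  then have "ennreal (B powr (p - 1)) * ennreal (c powr p * B) \<le> ennreal (B powr (p - 1)) * ?I"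
    by (rule mult_left_mono) simp
  moreover have "ennreal (B powr (p - 1)) * ennreal (c powr p * B) = ennreal (v powr p)"
    using B v by (simp add: ennreal_mult[symmetric] c_def powr_divide powr_diff)
  ultimately show ?thesis by simp
qed

text \<open>Jensen at each point \<open>x\<close>, followed by Tonelli. The bound \<open>I\<close>
  is asked for only where \<open>b\<close> is positive, so \<open>k\<close> has to be controlled
  only on the parameter range actually integrated over.\<close>

lemma Minkowski_nn_integral:
  fixes b :: "'t \<Rightarrow> real" and k :: "'a \<Rightarrow> 't \<Rightarrow> real" and v :: "'a \<Rightarrow> real"
  assumes "sigma_finite_measure M" "sigma_finite_measure N"
    and p: "1 < p" and B: "0 < B"
    and b_meas [measurable]: "b \<in> borel_measurable N"
    and k_meas [measurable]: "case_prod k \<in> borel_measurable (M \<Otimes>\<^sub>M N)"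
    and v: "\<And>x. 0 \<le> v x" and b: "\<And>t. 0 \<le> b t" and k: "\<And>x t. 0 \<le> k x t"
    and bB: "(\<integral>\<^sup>+t. ennreal (b t) \<partial>N) = ennreal B"
    and vle: "\<And>x. x \<in> space M \<Longrightarrow> ennreal (v x) \<le> (\<integral>\<^sup>+t. ennreal (b t * k x t) \<partial>N)"
    and kI: "\<And>t. 0 < b t \<Longrightarrow> (\<integral>\<^sup>+x. ennreal (k x t powr p) \<partial>M) \<le> I"
  shows "(\<integral>\<^sup>+x. ennreal (v x powr p) \<partial>M) \<le> ennreal (B powr p) * I"
proof -
  interpret pair_sigma_finite M N
    using assms(1,2) by (simp add: pair_sigma_finite_def)
  have "(\<integral>\<^sup>+x. ennreal (v x powr p) \<partial>M)
      \<le> (\<integral>\<^sup>+x. ennreal (B powr (p - 1)) * (\<integral>\<^sup>+t. ennreal (b t * k x t powr p) \<partial>N) \<partial>M)"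
    by (intro nn_integral_mono nn_integral_powr_Jensen p B v b k bB vle) measurable
  also have "\<dots> = ennreal (B powr (p - 1)) * (\<integral>\<^sup>+x. (\<integral>\<^sup>+t. ennreal (b t * k x t powr p) \<partial>N) \<partial>M)"
    by (rule nn_integral_cmult) measurable
  also have "(\<integral>\<^sup>+x. (\<integral>\<^sup>+t. ennreal (b t * k x t powr p) \<partial>N) \<partial>M)
      = (\<integral>\<^sup>+t. (\<integral>\<^sup>+x. ennreal (b t * k x t powr p) \<partial>M) \<partial>N)"
    by (rule Fubini'[symmetric]) measurable
  also have "\<dots> \<le> (\<integral>\<^sup>+t. ennreal (b t) * I \<partial>N)"
  proof (rule nn_integral_mono)
    fix t assume [measurable]: "t \<in> space N"
    have "(\<integral>\<^sup>+x. ennreal (b t * k x t powr p) \<partial>M) = ennreal (b t) * (\<integral>\<^sup>+x. ennreal (k x t powr p) \<partial>M)"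
      by (simp add: ennreal_mult b nn_integral_cmult)
    also have "\<dots> \<le> ennreal (b t) * I"
      using kI[of t] b[of t] by (cases "b t = 0") (auto intro!: mult_left_mono)
    finally show "(\<integral>\<^sup>+x. ennreal (b t * k x t powr p) \<partial>M) \<le> ennreal (b t) * I" .
  qed
  also have "\<dots> = ennreal B * I"
    by (simp add: nn_integral_multc bB)
  also have "ennreal (B powr (p - 1)) * (ennreal B * I) = ennreal (B powr p) * I"
    using B by (simp add: ennreal_mult[symmetric] mult.assoc[symmetric] powr_diff)
  finally show ?thesis
    by (simp add: mult_left_mono)
qed

section \<open>Increments along curves, and linear changes of variables\<close>

lemma norm_diff_le_nn_integral_derivative:
  fixes f :: "real \<Rightarrow> 'a::euclidean_space"
  assumes "a \<le> b"
    and "\<And>t. (f has_vector_derivative f' t) (at t)"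
    and "continuous_on UNIV f'"
  shows "ennreal (norm (f b - f a)) \<le> (\<integral>\<^sup>+t. ennreal (norm (f' t)) * indicator {a..b} t \<partial>lborel)"
proof -
  have c: "continuous_on {a..b} f'"
    using assms(3) continuous_on_subset by blast
  have "(\<integral>t. indicator {a..b} t *\<^sub>R f' t \<partial>lborel) = f b - f a"
    by (rule integral_FTC_atLeastAtMost[OF assms(1) _ c])
       (use assms(2) has_vector_derivative_at_within in blast)
  then have "ennreal (norm (f b - f a)) \<le> (\<integral>\<^sup>+t. ennreal (norm (indicator {a..b} t *\<^sub>R f' t)) \<partial>lborel)"
    using integral_norm_bound_ennreal[OF borel_integrable_atLeastAtMost'[OF c, unfolded set_integrable_def]]
    by simp
  also have "\<dots> = (\<integral>\<^sup>+t. ennreal (norm (f' t)) * indicator {a..b} t \<partial>lborel)"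
    by (intro nn_integral_cong) (auto split: split_indicator)
  finally show ?thesis .
qed

lemma nn_integral_lborel_scale:
  fixes f :: "'a::euclidean_space \<Rightarrow> ennreal"
  assumes [measurable]: "f \<in> borel_measurable borel" and "c \<noteq> 0"
  shows "(\<integral>\<^sup>+x. f x \<partial>lborel) = ennreal (\<bar>c\<bar> ^ DIM('a)) * (\<integral>\<^sup>+x. f (c *\<^sub>R x) \<partial>lborel)"
  by (subst lborel_affine[OF assms(2), of 0])
     (simp add: nn_integral_density nn_integral_distr nn_integral_cmult)

text \<open>The image of \<open>lborel\<close> under \<open>T\<close> agrees with
  \<open>lborel\<close> on boxes: the preimage of a box is its image under the orthogonal map
  \<open>inv T\<close>, which preserves Lebesgue measure.\<close>

lemma nn_integral_lborel_orthogonal: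
  fixes f :: "real^'n::{finite,wellorder} \<Rightarrow> ennreal" and T :: "real^'n::_ \<Rightarrow> real^'n::_"
  assumes [measurable]: "f \<in> borel_measurable borel" and T: "orthogonal_transformation T"
  shows "(\<integral>\<^sup>+x. f (T x) \<partial>lborel) = (\<integral>\<^sup>+x. f x \<partial>lborel)"
proof -
  have lin: "linear T" using T by (rule orthogonal_transformation_linear)
  have [measurable]: "T \<in> borel_measurable borel"
    by (intro borel_measurable_continuous_onI linear_continuous_on) (simp add: lin linear_conv_bounded_linear[symmetric])
  have bij: "bij T" using T orthogonal_transformation_bij by blast
  have inv: "orthogonal_transformation (inv T)"
    using T by (rule orthogonal_transformation_inv)
  have "lborel = distr lborel borel T"
  proof (rule lborel_eqI)
    fix l u :: "real^'n::_"
    assume lu: "\<And>b. b \<in> Basis \<Longrightarrow> l \<bullet> b \<le> u \<bullet> b"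
    have lm: "box l u \<in> lmeasurable" by simp
    have eq: "T -` box l u = inv T ` box l u"
      using bij by (simp add: bij_vimage_eq_inv_image)
    have lm': "inv T ` box l u \<in> lmeasurable"
      by (rule measurable_orthogonal_image[OF inv lm])
    have bor: "T -` box l u \<in> sets borel"
      using measurable_sets_borel[of T borel "box l u"] by simp
    have "emeasure (distr lborel borel T) (box l u) = emeasure lborel (T -` box l u)"
      by (simp add: emeasure_distr)
    also have "\<dots> = emeasure lebesgue (T -` box l u)"
      using bor by (simp add: emeasure_completion)
    also have "\<dots> = ennreal (measure lebesgue (inv T ` box l u))"
      unfolding eq using lm' by (simp add: emeasure_eq_measure2 fmeasurableD)
    also have "\<dots> = ennreal (measure lebesgue (box l u))"
      using measure_orthogonal_image[OF inv lm] by simp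
    also have "\<dots> = ennreal (\<Prod>b\<in>Basis. (u - l) \<bullet> b)"
      using lu by (simp add: measure_completion)
    finally show "emeasure (distr lborel borel T) (box l u) = ennreal (\<Prod>b\<in>Basis. (u - l) \<bullet> b)" .
  qed simp
  then show ?thesis
    using nn_integral_distr[of T lborel borel f] by simp
qed

section \<open>Rotations of the plane\<close>

text \<open>Multiplication by \<open>\<i>\<close> when the plane is identified with the complex
  numbers. It generates the group \<open>rot\<close>, and away from the origin the potential is this
  vector field times \<open>\<alpha>\<close> over the squared norm.\<close>

definition rot_quarter :: "real^2 \<Rightarrow> real^2" where
  "rot_quarter x = vector [- x $ 2, x $ 1]"

definition rot :: "real \<Rightarrow> real^2 \<Rightarrow> real^2" where
  "rot t x = cos t *\<^sub>R x + sin t *\<^sub>R rot_quarter x"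

lemma rot_quarter_nth [simp]: "rot_quarter x $ 1 = - x $ 2" "rot_quarter x $ 2 = x $ 1"
  by (simp_all add: rot_quarter_def)

lemma linear_rot_quarter: "linear rot_quarter"
  by (rule linearI) (simp_all add: vec_eq_iff forall_2)

lemma norm_vec_2: "(norm (x :: 'a::real_normed_vector^2))\<^sup>2 = (norm (x $ 1))\<^sup>2 + (norm (x $ 2))\<^sup>2"
  by (simp add: norm_vec_def L2_set_def sum_2)

lemma norm_rot [simp]: "norm (rot t x) = norm x"
proof -
  have "(norm (rot t x))\<^sup>2 = ((cos t)\<^sup>2 + (sin t)\<^sup>2) * ((x $ 1)\<^sup>2 + (x $ 2)\<^sup>2)"
    unfolding norm_vec_2 rot_def by (simp add: power2_eq_square algebra_simps del: sin_cos_squared_add3)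
  then have "(norm (rot t x))\<^sup>2 = (norm x)\<^sup>2"
    unfolding norm_vec_2 by simp
  then show ?thesis by simp
qed

lemma orthogonal_transformation_rot: "orthogonal_transformation (rot t)"
  unfolding orthogonal_transformation
proof
  show "linear (rot t)"
    unfolding rot_def
    by (intro linear_compose_add linear_compose_scale_right linear_rot_quarter linear_ident)
qed simp

lemma rot_quarter_rot: "rot_quarter (rot t x) = (- sin t) *\<^sub>R x + cos t *\<^sub>R rot_quarter x"
  by (simp add: vec_eq_iff forall_2 rot_def)

lemma has_vector_derivative_rot: "((\<lambda>t. rot t x) has_vector_derivative rot_quarter (rot t x)) (at t)"
  unfolding rot_quarter_rot unfolding rot_def
  by (rule derivative_eq_intros | simp)+

lemma continuous_rot_quarter [continuous_intros]:
  "continuous_on S f \<Longrightarrow> continuous_on S (\<lambda>x. rot_quarter (f x))"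
  by (rule bounded_linear.continuous_on[OF linear_conv_bounded_linear[THEN iffD1, OF linear_rot_quarter]])

section \<open>Directional derivatives of test functions\<close>

text \<open>Written through partial derivatives, so that joint continuity in point and direction is
  inherited from them and the components of \<open>magnetic_grad\<close> can be compared
  directly.\<close>

definition dir_deriv :: "(real^2 \<Rightarrow> complex) \<Rightarrow> real^2 \<Rightarrow> real^2 \<Rightarrow> complex" where
  "dir_deriv u x h = of_real (h $ 1) * partial_deriv 1 u x + of_real (h $ 2) * partial_deriv 2 u x"

lemma dir_deriv_scaleR: "dir_deriv u x (c *\<^sub>R h) = of_real c * dir_deriv u x h"
  by (simp add: dir_deriv_def algebra_simps)

lemma Cc_infinity_continuous:
  assumes "u \<in> Cc_infinity"
  shows "continuous_on UNIV u" "continuous_on UNIV (partial_deriv j u)"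
proof -
  have "Ck 0 u" "Ck (Suc 0) u"
    using assms unfolding Cc_infinity_def by blast+
  then show "continuous_on UNIV u" "continuous_on UNIV (partial_deriv j u)"
    by auto
qed

lemma Cc_infinity_has_derivative:
  assumes "u \<in> Cc_infinity"
  shows "(u has_derivative dir_deriv u x) (at x)"
proof -
  have "Ck (Suc 0) u"
    using assms unfolding Cc_infinity_def by blast
  then have "u differentiable at x"
    by (simp add: differentiable_on_def)
  then have der: "(u has_derivative frechet_derivative u (at x)) (at x)"
    using frechet_derivative_works by blast
  then have lin: "linear (frechet_derivative u (at x))"
    by (rule has_derivative_linear)
  have "frechet_derivative u (at x) h = dir_deriv u x h" for h
  proof -
    have "h = h $ 1 *\<^sub>R axis 1 1 + h $ 2 *\<^sub>R axis 2 1"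
      by (simp add: vec_eq_iff forall_2 axis_def)
    then have "frechet_derivative u (at x) h
        = frechet_derivative u (at x) (h $ 1 *\<^sub>R axis 1 1 + h $ 2 *\<^sub>R axis 2 1)"
      by simp
    also have "\<dots> = dir_deriv u x h"
      unfolding linear_add[OF lin] linear_scale[OF lin] dir_deriv_def partial_deriv_def
      by (simp add: scaleR_conv_of_real)
    finally show ?thesis .
  qed
  then have "frechet_derivative u (at x) = dir_deriv u x" by blast
  with der show ?thesis by simp
qed

lemma Cc_infinity_has_vector_derivative:
  assumes "u \<in> Cc_infinity" and "(g has_vector_derivative g') (at t)"
  shows "((\<lambda>t. u (g t)) has_vector_derivative dir_deriv u (g t) g') (at t)"
proof -
  have "((\<lambda>t. u (g t)) has_derivative (\<lambda>s. dir_deriv u (g t) (s *\<^sub>R g'))) (at t)"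
    using has_derivative_compose[OF assms(2)[unfolded has_vector_derivative_def]
        Cc_infinity_has_derivative[OF assms(1), of "g t"]] .
  then show ?thesis
    unfolding has_vector_derivative_def dir_deriv_scaleR by (simp add: scaleR_conv_of_real)
qed

lemma continuous_on_dir_deriv:
  assumes "u \<in> Cc_infinity" "continuous_on S f" "continuous_on S g"
  shows "continuous_on S (\<lambda>s. dir_deriv u (f s) (g s))"
  unfolding dir_deriv_def
  by (intro continuous_intros assms
      continuous_on_compose2[OF Cc_infinity_continuous(2)[OF assms(1)]]) auto

lemma Cc_infinity_bounded_support:
  assumes "u \<in> Cc_infinity"
  obtains R where "0 < R" "\<And>x. R < norm x \<Longrightarrow> u x = 0"
proof -
  have "bounded {x. u x \<noteq> 0}"
    using assms bounded_subset[OF compact_imp_bounded closure_subset] by (auto simp: Cc_infinity_def)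
  then obtain R where "0 < R" "\<forall>x\<in>{x. u x \<noteq> 0}. norm x \<le> R"
    unfolding bounded_pos by blast
  then show ?thesis
    using that[of R] by force
qed

section \<open>The Hardy inequality for the radial derivative\<close>

lemma radial_Hardy:
  assumes p: "1 < p" "p < 2" and u: "u \<in> Cc_infinity"
  shows "(\<integral>\<^sup>+x. ennreal ((norm (u x) / norm x) powr p) \<partial>lborel)
    \<le> ennreal ((p / (2 - p)) powr p)
      * (\<integral>\<^sup>+x. ennreal ((norm (dir_deriv u x x) / norm x) powr p) \<partial>lborel)"
proof -
  define F where "F y = norm (dir_deriv u y y) / norm y" for y
  have "continuous_on UNIV (\<lambda>y. dir_deriv u y y)"
    by (intro continuous_on_dir_deriv u continuous_on_id)
  then have [measurable]: "(\<lambda>y. dir_deriv u y y) \<in> borel_measurable borel"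
    by (rule borel_measurable_continuous_onI)
  have [measurable]: "F \<in> borel_measurable borel"
    unfolding F_def by measurable
  have F0: "0 \<le> F y" for y by (simp add: F_def)
  \<comment> \<open>The powers of \<open>s\<close> in \<open>b\<close> and \<open>k\<close> cancel
    in the product. They are split so that every dilate \<open>k x s\<close> has the same
    \<open>p\<close>-integral as \<open>F\<close>, the modulus of the radial derivative; all decay
    then sits in \<open>b\<close>.\<close>
  define b where "b s = s powr (-2/p) * indicator {1..} s" for s :: real
  define k where "k x s = s powr (2/p) * F (s *\<^sub>R x)" for s and x
  have bB: "(\<integral>\<^sup>+s. ennreal (b s) \<partial>lborel) = ennreal (p / (2 - p))"
  proof -
    \<comment> \<open>This is where \<open>p < 2\<close> makes the total weight finite.\<close>
    have e: "1 - 2/p < 0" using p by (simp add: field_simps)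
    have ep: "-(p / (2 - p)) * (1 - 2/p) = 1" using p by (simp add: field_simps)
    have "(\<integral>\<^sup>+s. ennreal (b s) \<partial>lborel) = (\<integral>\<^sup>+s. ennreal (s powr (-2/p)) * indicator {1..} s \<partial>lborel)"
      by (intro nn_integral_cong) (auto simp: b_def split: split_indicator)
    also have "\<dots> = ennreal (0 - -(p / (2 - p)) * 1 powr (1 - 2/p))"
    proof (rule nn_integral_FTC_atLeast[where F = "\<lambda>s. -(p / (2 - p)) * s powr (1 - 2/p)"])
      fix s :: real assume "1 \<le> s"
      then have "((\<lambda>s. -(p / (2 - p)) * s powr (1 - 2/p)) has_real_derivative
          -(p / (2 - p)) * ((1 - 2/p) * s powr (1 - 2/p - 1))) (at s)"
        by (intro DERIV_cmult has_real_derivative_powr) auto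
      then show "((\<lambda>s. -(p / (2 - p)) * s powr (1 - 2/p)) has_real_derivative s powr (-2/p)) (at s)"
        unfolding mult.assoc[symmetric] ep by simp
    next
      show "((\<lambda>s. -(p / (2 - p)) * s powr (1 - 2/p)) \<longlongrightarrow> 0) at_top"
        using tendsto_mult_right_zero[OF tendsto_neg_powr[OF e filterlim_ident]] by blast
    qed auto
    finally show ?thesis by simp
  qed
  have vle: "ennreal (norm (u x) / norm x) \<le> (\<integral>\<^sup>+s. ennreal (b s * k x s) \<partial>lborel)" for x
  \<comment> \<open>At the origin the left side is 0, because division by zero yields zero.\<close>
  proof (cases "x = 0")
    case False
    obtain R where R: "0 < R" "\<And>y. R < norm y \<Longrightarrow> u y = 0"
      using Cc_infinity_bounded_support[OF u] by blast
    \<comment> \<open>The dilate by \<open>n\<close> has norm \<open>norm x + R\<close>, hence lies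
      outside the support, and the far boundary term vanishes.\<close>
    define n where "n = 1 + R / norm x"
    have "R < norm (n *\<^sub>R x)"
      using False R(1) by (simp add: n_def field_simps)
    then have un: "u (n *\<^sub>R x) = 0" by (rule R(2))
    have d: "((\<lambda>s. s *\<^sub>R x) has_vector_derivative x) (at s)" for s
      by (auto intro!: derivative_eq_intros simp: has_vector_derivative_def)
    have "ennreal (norm (u (n *\<^sub>R x) - u (1 *\<^sub>R x)))
        \<le> (\<integral>\<^sup>+s. ennreal (norm (dir_deriv u (s *\<^sub>R x) x)) * indicator {1..n} s \<partial>lborel)"
      by (rule norm_diff_le_nn_integral_derivative[where f = "\<lambda>s. u (s *\<^sub>R x)"])
         (use R(1) in \<open>auto simp: n_def intro!: Cc_infinity_has_vector_derivative u d
             continuous_on_dir_deriv continuous_intros\<close>)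
    also have "\<dots> \<le> (\<integral>\<^sup>+s. ennreal (norm x) * ennreal (b s * k x s) \<partial>lborel)"
    proof (intro nn_integral_mono)
      fix s :: real
      show "ennreal (norm (dir_deriv u (s *\<^sub>R x) x)) * indicator {1..n} s
          \<le> ennreal (norm x) * ennreal (b s * k x s)"
      proof (cases "1 \<le> s")
        case True
        then have "norm x * (b s * k x s) = norm (dir_deriv u (s *\<^sub>R x) x)"
          using False by (simp add: b_def k_def F_def dir_deriv_scaleR norm_mult powr_minus field_simps)
        then show ?thesis
          by (auto simp: ennreal_mult'[symmetric] split: split_indicator)
      qed auto
    qed
    also have "\<dots> = ennreal (norm x) * (\<integral>\<^sup>+s. ennreal (b s * k x s) \<partial>lborel)"
      unfolding b_def k_def by (rule nn_integral_cmult) measurable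
    finally have "ennreal (1 / norm x) * ennreal (norm (u x))
        \<le> ennreal (1 / norm x) * (ennreal (norm x) * (\<integral>\<^sup>+s. ennreal (b s * k x s) \<partial>lborel))"
      by (intro mult_left_mono) (auto simp: un)
    then show ?thesis
      using False by (simp add: ennreal_mult'[symmetric] mult.assoc[symmetric])
  qed simp
  have kI: "(\<integral>\<^sup>+x. ennreal (k x s powr p) \<partial>lborel) \<le> (\<integral>\<^sup>+x. ennreal (F x powr p) \<partial>lborel)"
    if "0 < b s" for s
  proof -
    have s: "1 \<le> s" using that by (auto simp: b_def split: split_indicator_asm)
    \<comment> \<open>The \<open>p\<close>-th power turns \<open>s powr (2/p)\<close> into the
      square of \<open>s\<close>, the Jacobian of the dilation in dimension 2.\<close>
    have "(\<integral>\<^sup>+x. ennreal (k x s powr p) \<partial>lborel)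
        = (\<integral>\<^sup>+x. ennreal (\<bar>s\<bar> ^ DIM(real^2)) * ennreal (F (s *\<^sub>R x) powr p) \<partial>lborel)"
      using s p by (intro nn_integral_cong)
        (simp add: k_def F0 powr_mult powr_powr ennreal_mult'[symmetric])
    also have "\<dots> = ennreal (\<bar>s\<bar> ^ DIM(real^2)) * (\<integral>\<^sup>+x. ennreal (F (s *\<^sub>R x) powr p) \<partial>lborel)"
      by (rule nn_integral_cmult) measurable
    also have "\<dots> = (\<integral>\<^sup>+x. ennreal (F x powr p) \<partial>lborel)"
      using s by (intro nn_integral_lborel_scale[symmetric]) auto
    finally show ?thesis by simp
  qed
  have "(\<integral>\<^sup>+x. ennreal ((norm (u x) / norm x) powr p) \<partial>lborel)
    \<le> ennreal ((p / (2 - p)) powr p) * (\<integral>\<^sup>+x. ennreal (F x powr p) \<partial>lborel)"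
  proof (rule Minkowski_nn_integral[where b = b and k = k and N = lborel])
    show "case_prod k \<in> borel_measurable (lborel \<Otimes>\<^sub>M lborel)"
      unfolding k_def by measurable
    show "b \<in> borel_measurable lborel"
      unfolding b_def by measurable
    show "0 \<le> b s" for s by (simp add: b_def)
    show "0 \<le> k x s" for x s by (simp add: k_def F0)
    show "0 < p / (2 - p)" using p by simp
  qed (simp_all add: p(1) bB vle kI lborel.sigma_finite_measure_axioms)
  then show ?thesis by (simp add: F_def)
qed

section \<open>The inequality for the angular covariant derivative\<close>

lemma sinh_quotient_pos: "0 < sinh_quotient \<nu>"
  by (auto simp: sinh_quotient_def)

lemma exp_period_split: "exp (\<nu> * (2 * pi)) = exp (pi * \<nu>) * exp (pi * \<nu>)" for \<nu> :: real
  by (simp add: mult_exp_exp)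

text \<open>Factoring \<open>exp (pi * \<nu>)\<close> out of \<open>exp (2 * pi * \<nu>) - 1\<close>
  leaves twice a hyperbolic sine. For \<open>\<nu> = 0\<close> the value is \<open>2 * pi\<close>,
  in accordance with the convention \<open>1 / pi\<close>.\<close>

lemma nn_integral_exp_period:
  "(\<integral>\<^sup>+t. ennreal (exp (\<nu> * t)) * indicator {0..2*pi} t \<partial>lborel) = ennreal (2 * exp (pi * \<nu>) / sinh_quotient \<nu>)"
proof (cases "\<nu> = 0")
  case True
  then show ?thesis by (simp add: sinh_quotient_def nn_integral_cmult_indicator)
next
  case False
  have "(\<integral>\<^sup>+t. ennreal (exp (\<nu> * t)) * indicator {0..2*pi} t \<partial>lborel)
      = ennreal (exp (\<nu> * (2*pi)) / \<nu> - exp (\<nu> * 0) / \<nu>)"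
    by (rule nn_integral_FTC_Icc[where F = "\<lambda>t. exp (\<nu> * t) / \<nu>"])
       (use False in \<open>auto intro!: derivative_eq_intros\<close>)
  also have "exp (\<nu> * (2*pi)) / \<nu> - exp (\<nu> * 0) / \<nu> = 2 * exp (pi * \<nu>) * (sinh (pi * \<nu>) / \<nu>)"
    unfolding exp_period_split using False by (simp add: sinh_def exp_minus field_simps)
  also have "sinh (pi * \<nu>) / \<nu> = 1 / sinh_quotient \<nu>"
    using False by (auto simp: sinh_quotient_def abs_if)
  finally show ?thesis by simp
qed

text \<open>With \<open>E = exp (pi * \<nu>)\<close> the exponential has modulus
  \<open>E * E\<close> and argument \<open>- 2 * pi * \<mu>\<close> modulo full turns. Half-angle
  formulas and \<open>E * E - 1 = 2 * E * sinh (pi * \<nu>)\<close> give the square of the norm. The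
  factor \<open>2 * E\<close> cancels against \<open>nn_integral_exp_period\<close>.\<close>

lemma norm_holonomy:
  "norm (exp (- (\<i> * Complex \<mu> \<nu> * of_real (2*pi))) - 1)
    = 2 * exp (pi * \<nu>) * sqrt ((sin (pi * \<mu>))\<^sup>2 + (sinh (pi * \<nu>))\<^sup>2)"
proof (rule power2_eq_imp_eq)
  let ?E = "exp (pi * \<nu>)" and ?c = "cos (pi * \<mu>)" and ?s = "sin (pi * \<mu>)"
  let ?w = "exp (- (\<i> * Complex \<mu> \<nu> * of_real (2*pi)))"
  have Re: "Re ?w = ?E * ?E * (?c\<^sup>2 - ?s\<^sup>2)" and Im: "Im ?w = - (?E * ?E * (2 * ?s * ?c))"
    using cos_double[of "pi * \<mu>"] sin_double[of "pi * \<mu>"] exp_period_split[of \<nu>]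
    by (simp_all add: Re_exp Im_exp mult_ac)
  have c2: "?c\<^sup>2 = 1 - ?s\<^sup>2" by (simp add: cos_squared_eq)
  have sh: "2 * ?E * sinh (pi * \<nu>) = ?E * ?E - 1"
    by (simp add: sinh_def field_simps exp_minus)
  have "(norm (?w - 1))\<^sup>2 = (?E * ?E * (?c\<^sup>2 - ?s\<^sup>2) - 1)\<^sup>2 + (?E * ?E)\<^sup>2 * (4 * ?s\<^sup>2 * ?c\<^sup>2)"
    unfolding cmod_power2 minus_complex.sel Re Im by (simp add: power2_eq_square)
  also have "\<dots> = (?E * ?E - 1)\<^sup>2 + 4 * (?E * ?E) * ?s\<^sup>2"
    unfolding c2 by (simp add: power2_eq_square algebra_simps)
  also have "\<dots> = (2 * ?E)\<^sup>2 * (?s\<^sup>2 + (sinh (pi * \<nu>))\<^sup>2)"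
    unfolding sh[symmetric] by (simp add: power2_eq_square algebra_simps)
  finally show "(norm (?w - 1))\<^sup>2 = (2 * ?E * sqrt (?s\<^sup>2 + (sinh (pi * \<nu>))\<^sup>2))\<^sup>2"
    by (simp add: power_mult_distrib)
qed auto

text \<open>Transport around the circle through \<open>x\<close> returns to \<open>x\<close> with a
  phase factor. As that factor differs from 1, the increment over one turn controls
  \<open>u x\<close> itself; the constant \<open>K\<close> is the reciprocal of the total
  weight.\<close>

lemma angular_inequality:
  fixes \<mu> \<nu> p :: real
  defines "K \<equiv> sinh_quotient \<nu> * sqrt ((sin (pi * \<mu>))\<^sup>2 + (sinh (pi * \<nu>))\<^sup>2)"
  assumes p: "1 < p" and K: "0 < K" and u: "u \<in> Cc_infinity"
  shows "(\<integral>\<^sup>+x. ennreal ((norm (u x) / norm x) powr p) \<partial>lborel)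
    \<le> ennreal ((1 / K) powr p)
      * (\<integral>\<^sup>+x. ennreal ((norm (dir_deriv u x (rot_quarter x) - \<i> * Complex \<mu> \<nu> * u x) / norm x) powr p) \<partial>lborel)"
proof -
  define \<alpha> where "\<alpha> = Complex \<mu> \<nu>"
  define f where "f y = dir_deriv u y (rot_quarter y) - \<i> * \<alpha> * u y" for y
  define G where "G y = norm (f y) / norm y" for y
  define c where "c = norm (exp (- (\<i> * \<alpha> * of_real (2*pi))) - 1)"
  have c_eq: "c = 2 * exp (pi * \<nu>) * sqrt ((sin (pi * \<mu>))\<^sup>2 + (sinh (pi * \<nu>))\<^sup>2)"
    unfolding c_def \<alpha>_def by (rule norm_holonomy)
  have "0 < sqrt ((sin (pi * \<mu>))\<^sup>2 + (sinh (pi * \<nu>))\<^sup>2)"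
    using K sinh_quotient_pos[of \<nu>] unfolding K_def by (simp add: zero_less_mult_iff)
  then have c: "0 < c"
    unfolding c_eq by simp
  have cont_f: "continuous_on UNIV f"
    unfolding f_def
    by (intro continuous_intros continuous_on_dir_deriv u Cc_infinity_continuous(1)[OF u])
  have [measurable]: "f \<in> borel_measurable borel"
    by (intro borel_measurable_continuous_onI cont_f)
  have [measurable]: "G \<in> borel_measurable borel"
    unfolding G_def by measurable
  have [measurable]: "rot_quarter \<in> borel_measurable borel"
    by (intro borel_measurable_continuous_onI continuous_intros)
  have G0: "0 \<le> G y" for y by (simp add: G_def)
  \<comment> \<open>The weight takes up the modulus of the exponential factor in
    \<open>\<psi>'\<close> and the division by the holonomy \<open>c\<close>.\<close>
  define b where "b t = exp (\<nu> * t) / c * indicator {0..2*pi} t" for t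
  define k where "k x t = G (rot t x)" for x t
  have bB: "(\<integral>\<^sup>+t. ennreal (b t) \<partial>lborel) = ennreal (1 / K)"
  proof -
    have "(\<integral>\<^sup>+t. ennreal (b t) \<partial>lborel)
        = (\<integral>\<^sup>+t. ennreal (1 / c) * (ennreal (exp (\<nu> * t)) * indicator {0..2*pi} t) \<partial>lborel)"
      using c by (intro nn_integral_cong)
        (auto simp: b_def ennreal_mult'[symmetric] split: split_indicator)
    also have "\<dots> = ennreal (1 / c) * ennreal (2 * exp (pi * \<nu>) / sinh_quotient \<nu>)"
      by (subst nn_integral_cmult) (simp_all add: nn_integral_exp_period)
    also have "\<dots> = ennreal (1 / K)"
      using c by (simp add: ennreal_mult'[symmetric] c_eq K_def) (simp add: mult.commute)
    finally show ?thesis .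
  qed
  have vle: "ennreal (norm (u x) / norm x) \<le> (\<integral>\<^sup>+t. ennreal (b t * k x t) \<partial>lborel)" for x
  proof (cases "x = 0")
    case False
    \<comment> \<open>The gauge factor turns the covariant angular derivative into an ordinary one:
      differentiating it produces exactly the term \<open>- \<i> * \<alpha> * u\<close>.\<close>
    define \<psi> where "\<psi> t = exp (- (\<i> * \<alpha> * of_real t)) * u (rot t x)" for t
    define \<psi>' where "\<psi>' t = exp (- (\<i> * \<alpha> * of_real t)) * f (rot t x)" for t
    have crot: "continuous_on UNIV (\<lambda>t. rot t x)"
      unfolding rot_def by (intro continuous_intros)
    have der: "(\<psi> has_vector_derivative \<psi>' t) (at t)" for t
    proof -
      have "((\<lambda>t. exp (- (\<i> * \<alpha> * of_real t))) has_vector_derivative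
          exp (- (\<i> * \<alpha> * of_real t)) * (- (\<i> * \<alpha>))) (at t)"
        by (rule has_vector_derivative_real_field) (auto intro!: derivative_eq_intros)
      from has_vector_derivative_mult[OF this
          Cc_infinity_has_vector_derivative[OF u has_vector_derivative_rot[of x t]]]
      show ?thesis
        unfolding \<psi>_def \<psi>'_def f_def by (simp add: algebra_simps)
    qed
    have cont': "continuous_on UNIV \<psi>'"
      unfolding \<psi>'_def
      by (intro continuous_intros continuous_on_compose2[OF cont_f crot]) auto
    have rot0: "rot 0 x = x" and rot2pi: "rot (2*pi) x = x"
      by (simp_all add: rot_def)
    have "\<psi> (2*pi) - \<psi> 0 = (exp (- (\<i> * \<alpha> * of_real (2*pi))) - 1) * u x"
      unfolding \<psi>_def rot0 rot2pi by (simp add: algebra_simps)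
    then have diff: "norm (\<psi> (2*pi) - \<psi> 0) = c * norm (u x)"
      by (simp only: norm_mult c_def)
    have norm': "norm (\<psi>' t) = exp (\<nu> * t) * norm (f (rot t x))" for t
      by (simp add: \<psi>'_def norm_mult \<alpha>_def)
    have "ennreal (norm (\<psi> (2*pi) - \<psi> 0)) \<le> (\<integral>\<^sup>+t. ennreal (norm (\<psi>' t)) * indicator {0..2*pi} t \<partial>lborel)"
      by (rule norm_diff_le_nn_integral_derivative[OF _ der cont']) simp
    also have "\<dots> = (\<integral>\<^sup>+t. ennreal (c * norm x) * ennreal (b t * k x t) \<partial>lborel)"
      using c False by (intro nn_integral_cong)
        (auto simp: norm' b_def k_def G_def ennreal_mult'[symmetric] split: split_indicator)
    also have "\<dots> = ennreal (c * norm x) * (\<integral>\<^sup>+t. ennreal (b t * k x t) \<partial>lborel)"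
      unfolding b_def k_def rot_def by (rule nn_integral_cmult) measurable
    finally have "ennreal (1 / (c * norm x)) * ennreal (c * norm (u x))
        \<le> ennreal (1 / (c * norm x)) * (ennreal (c * norm x) * (\<integral>\<^sup>+t. ennreal (b t * k x t) \<partial>lborel))"
      unfolding diff by (intro mult_left_mono) auto
    then show ?thesis
      using False c by (simp add: ennreal_mult'[symmetric] mult.assoc[symmetric])
  qed simp
  have kI: "(\<integral>\<^sup>+x. ennreal (k x t powr p) \<partial>lborel) = (\<integral>\<^sup>+x. ennreal (G x powr p) \<partial>lborel)" for t
    unfolding k_def by (rule nn_integral_lborel_orthogonal[OF _ orthogonal_transformation_rot]) measurable
  have "(\<integral>\<^sup>+x. ennreal ((norm (u x) / norm x) powr p) \<partial>lborel)
    \<le> ennreal ((1 / K) powr p) * (\<integral>\<^sup>+x. ennreal (G x powr p) \<partial>lborel)"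
  proof (rule Minkowski_nn_integral[where b = b and k = k and N = lborel])
    show "case_prod k \<in> borel_measurable (lborel \<Otimes>\<^sub>M lborel)"
      unfolding k_def rot_def by measurable
    show "b \<in> borel_measurable lborel"
      unfolding b_def by measurable
    show "0 \<le> b t" for t using c by (simp add: b_def)
    show "0 \<le> k x t" for x t by (simp add: k_def G0)
    show "0 < 1 / K" using K by simp
  qed (simp_all add: p bB vle kI lborel.sigma_finite_measure_axioms)
  then show ?thesis by (simp add: G_def f_def \<alpha>_def)
qed

section \<open>Combination of the radial and angular estimates\<close>

text \<open>The vectors \<open>x\<close> and \<open>rot_quarter x\<close> are orthogonal of length
  \<open>norm x\<close>, so Pythagoras applies to the components along them. The potential is
  orthogonal to \<open>x\<close>, hence enters only the angular component.\<close>

lemma norm_magnetic_grad_AB: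
  assumes "x \<noteq> 0"
  shows "(norm (magnetic_grad (AB_potential \<alpha>) u x))\<^sup>2
    = (norm (dir_deriv u x x) / norm x)\<^sup>2
      + (norm (dir_deriv u x (rot_quarter x) - \<i> * \<alpha> * u x) / norm x)\<^sup>2"
proof -
  define n where "n = (norm x)\<^sup>2"
  have n: "n = x $ 1 * x $ 1 + x $ 2 * x $ 2" "n \<noteq> 0"
    using assms norm_vec_2[of x] by (auto simp: n_def power2_eq_square)
  define w where "w = magnetic_grad (AB_potential \<alpha>) u x"
  define \<beta> where "\<beta> = \<i> * u x * (\<alpha> / of_real n)"
  have w1: "w $ 1 = partial_deriv 1 u x + \<beta> * of_real (x $ 2)"
    and w2: "w $ 2 = partial_deriv 2 u x - \<beta> * of_real (x $ 1)"
    by (simp_all add: w_def magnetic_grad_def AB_potential_def n_def \<beta>_def)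
  have rad: "dir_deriv u x x = of_real (x $ 1) * w $ 1 + of_real (x $ 2) * w $ 2"
    by (simp add: dir_deriv_def w1 w2 algebra_simps)
  have "\<i> * \<alpha> * u x = \<beta> * of_real n"
    using n(2) by (simp add: \<beta>_def)
  then have "\<i> * \<alpha> * u x = \<beta> * (of_real (x $ 1) * of_real (x $ 1) + of_real (x $ 2) * of_real (x $ 2))"
    by (simp add: n(1))
  then have ang: "dir_deriv u x (rot_quarter x) - \<i> * \<alpha> * u x = - of_real (x $ 2) * w $ 1 + of_real (x $ 1) * w $ 2"
    by (simp add: dir_deriv_def w1 w2 algebra_simps)
  have "(norm (dir_deriv u x x))\<^sup>2 + (norm (dir_deriv u x (rot_quarter x) - \<i> * \<alpha> * u x))\<^sup>2
      = n * ((norm (w $ 1))\<^sup>2 + (norm (w $ 2))\<^sup>2)"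
    unfolding rad ang cmod_power2 n(1) by (simp add: power2_eq_square algebra_simps)
  then have "(norm (dir_deriv u x x))\<^sup>2 + (norm (dir_deriv u x (rot_quarter x) - \<i> * \<alpha> * u x))\<^sup>2
      = n * (norm w)\<^sup>2"
    by (simp only: norm_vec_2)
  then show ?thesis
    using n(2) unfolding w_def[symmetric] power_divide n_def[symmetric] by (simp add: field_simps)
qed

text \<open>After division by \<open>S\<close>, Young's inequality with weights \<open>p/2\<close>
  and \<open>1 - p/2\<close> applies to each term, and the bounds add up to 1. Equality holds when
  \<open>l\<close> is the share of the squared \<open>a\<close> in \<open>S\<close>.\<close>

lemma sum_squares_powr_ge:
  fixes a b l p :: real
  assumes "0 \<le> a" "0 \<le> b" "0 \<le> l" "l \<le> 1" "0 < p" "p \<le> 2"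
  shows "l powr (1 - p/2) * a powr p + (1 - l) powr (1 - p/2) * b powr p \<le> (a\<^sup>2 + b\<^sup>2) powr (p/2)"
proof (cases "a\<^sup>2 + b\<^sup>2 = 0")
  case True
  then show ?thesis by (simp add: sum_power2_eq_zero_iff)
next
  case False
  define S where "S = a\<^sup>2 + b\<^sup>2"
  have S: "0 < S" using False by (simp add: S_def less_le)
  have sq: "x powr p = S powr (p/2) * (x\<^sup>2 / S) powr (p/2)" if "0 \<le> x" for x
  proof -
    have "(x\<^sup>2) powr (p/2) = x powr p"
      using that powr_powr[of x 2 "p/2"] by (cases "x = 0") (auto simp: powr_numeral)
    then show ?thesis
      using S by (simp add: powr_divide)
  qed
  have young: "(x\<^sup>2 / S) powr (p/2) * m powr (1 - p/2) \<le> p/2 * (x\<^sup>2 / S) + (1 - p/2) * m" if "0 \<le> m" for x m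
    using that S assms by (intro weighted_powr_mult_le) auto
  have "l powr (1 - p/2) * a powr p + (1 - l) powr (1 - p/2) * b powr p
      = S powr (p/2) * ((a\<^sup>2 / S) powr (p/2) * l powr (1 - p/2) + (b\<^sup>2 / S) powr (p/2) * (1 - l) powr (1 - p/2))"
    unfolding sq[OF assms(1)] sq[OF assms(2)] by (simp add: algebra_simps)
  also have "\<dots> \<le> S powr (p/2) * ((p/2 * (a\<^sup>2 / S) + (1 - p/2) * l) + (p/2 * (b\<^sup>2 / S) + (1 - p/2) * (1 - l)))"
    using assms by (intro mult_left_mono add_mono young) auto
  also have "(p/2 * (a\<^sup>2 / S) + (1 - p/2) * l) + (p/2 * (b\<^sup>2 / S) + (1 - p/2) * (1 - l))
      = p/2 * ((a\<^sup>2 + b\<^sup>2) / S) + (1 - p/2)"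
    using S by (simp add: field_simps)
  also have "\<dots> = 1"
    using S unfolding S_def[symmetric] by simp
  finally show ?thesis by (simp add: S_def)
qed

text \<open>If both squares vanish, then \<open>\<nu> = 0\<close> and \<open>\<mu>\<close> is an
  integer. This is how \<open>\<alpha> \<notin> \<int>\<close> enters.\<close>

lemma holonomy_pos:
  assumes "Complex \<mu> \<nu> \<notin> \<int>"
  shows "0 < (sin (pi * \<mu>))\<^sup>2 + (sinh (pi * \<nu>))\<^sup>2"
proof (rule ccontr)
  assume "\<not> ?thesis"
  then have "(sin (pi * \<mu>))\<^sup>2 + (sinh (pi * \<nu>))\<^sup>2 = 0"
    by (smt (verit) zero_le_power2)
  then have "sin (pi * \<mu>) = 0" and \<nu>: "\<nu> = 0"
    by (auto simp: sum_power2_eq_zero_iff)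
  then obtain i :: int where "\<mu> = of_int i"
    by (auto simp: sin_zero_iff_int2)
  then have "Complex \<mu> \<nu> = of_int i"
    using \<nu> by (simp add: complex_eq_iff)
  with assms show False by simp
qed

theorem corollary4p2:
  fixes p \<mu> \<nu> :: real and \<alpha> :: complex and u :: "real^2 \<Rightarrow> complex"
  assumes "1 < p" and "p < 2"
    and "\<alpha> = Complex \<mu> \<nu>" and "\<alpha> \<notin> \<int>"
    and "u \<in> Cc_infinity"
  shows "(\<integral>\<^sup>+ x. ennreal (norm (magnetic_grad (AB_potential \<alpha>) u x) powr p) \<partial>lborel)
    \<ge> ennreal ((((2 - p) / p)\<^sup>2
          + (sinh_quotient \<nu>)\<^sup>2 * ((sin (pi * \<mu>))\<^sup>2 + (sinh (pi * \<nu>))\<^sup>2)) powr (p / 2))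
      * (\<integral>\<^sup>+ x. ennreal (norm (u x) powr p / norm x powr p) \<partial>lborel)"
proof -
  define A where "A = (2 - p) / p"
  define K where "K = sinh_quotient \<nu> * sqrt ((sin (pi * \<mu>))\<^sup>2 + (sinh (pi * \<nu>))\<^sup>2)"
  define S where "S = A\<^sup>2 + K\<^sup>2"
  \<comment> \<open>The equality case of \<open>sum_squares_powr_ge\<close> for \<open>a = A\<close>
    and \<open>b = K\<close>, so that nothing is lost in the constant.\<close>
  define l where "l = A\<^sup>2 / S"
  define H where "H = (\<integral>\<^sup>+x. ennreal ((norm (u x) / norm x) powr p) \<partial>lborel)"
  define F where "F x = norm (dir_deriv u x x) / norm x" for x
  define G where "G x = norm (dir_deriv u x (rot_quarter x) - \<i> * \<alpha> * u x) / norm x" for x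
  note u = assms(5)
  have A: "0 < A" using assms(1,2) by (simp add: A_def)
  have pos: "0 < (sin (pi * \<mu>))\<^sup>2 + (sinh (pi * \<nu>))\<^sup>2"
    using holonomy_pos assms(3,4) by blast
  then have K: "0 < K" by (simp add: K_def sinh_quotient_pos)
  have K2: "K\<^sup>2 = (sinh_quotient \<nu>)\<^sup>2 * ((sin (pi * \<mu>))\<^sup>2 + (sinh (pi * \<nu>))\<^sup>2)"
    using pos by (simp add: K_def power_mult_distrib)
  have S: "0 < S" using A K by (simp add: S_def add_pos_pos)
  have l: "0 < l" "0 < 1 - l" and AlS: "A\<^sup>2 = l * S" and KlS: "K\<^sup>2 = (1 - l) * S"
    using A K S by (auto simp: l_def S_def field_simps)
  have [measurable]: "(\<lambda>x. dir_deriv u x x) \<in> borel_measurable borel"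
    "(\<lambda>x. dir_deriv u x (rot_quarter x)) \<in> borel_measurable borel" "u \<in> borel_measurable borel"
    by (intro borel_measurable_continuous_onI continuous_on_dir_deriv continuous_intros u
        Cc_infinity_continuous(1))+
  have [measurable]: "F \<in> borel_measurable borel" "G \<in> borel_measurable borel"
    unfolding F_def G_def by measurable
  have invert: "ennreal (c powr p) * H \<le> J" if "0 < c" "H \<le> ennreal ((1 / c) powr p) * J" for c J
  proof -
    have "ennreal (c powr p) * H \<le> ennreal (c powr p) * (ennreal ((1 / c) powr p) * J)"
      by (rule mult_left_mono[OF that(2)]) simp
    also have "\<dots> = J"
      using that(1) by (simp add: mult.assoc[symmetric] ennreal_mult'[symmetric] powr_mult[symmetric])
    finally show ?thesis .
  qed
  have HF: "ennreal (A powr p) * H \<le> (\<integral>\<^sup>+x. ennreal (F x powr p) \<partial>lborel)"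
    using radial_Hardy[OF assms(1,2) u] A by (intro invert) (auto simp: H_def F_def A_def)
  have HG: "ennreal (K powr p) * H \<le> (\<integral>\<^sup>+x. ennreal (G x powr p) \<partial>lborel)"
    using angular_inequality[OF assms(1) K[unfolded K_def] u] K
    by (intro invert) (auto simp: H_def G_def K_def assms(3))
  let ?e = "1 - p / 2"
  \<comment> \<open>Used for \<open>m = l\<close> and \<open>m = 1 - l\<close>, whose contributions
    sum to \<open>S powr (p / 2)\<close>.\<close>
  have weight: "m powr ?e * c powr p = m * S powr (p / 2)" if "0 < c" "0 < m" "c\<^sup>2 = m * S" for c m
  proof -
    have "c powr p = (c\<^sup>2) powr (p / 2)"
      using that(1) powr_powr[of c 2 "p/2"] by (simp add: powr_numeral)
    also have "\<dots> = m powr (p / 2) * S powr (p / 2)"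
      using that S by (simp add: powr_mult)
    finally show ?thesis
      using that(2) by (simp add: mult.assoc[symmetric] powr_add[symmetric])
  qed
  have "ennreal (S powr (p / 2)) * H = ennreal (l powr ?e * A powr p + (1 - l) powr ?e * K powr p) * H"
    by (simp add: weight[OF A l(1) AlS] weight[OF K l(2) KlS] distrib_right[symmetric])
  also have "\<dots> = ennreal (l powr ?e) * (ennreal (A powr p) * H)
      + ennreal ((1 - l) powr ?e) * (ennreal (K powr p) * H)"
    by (simp add: ennreal_mult' distrib_right mult.assoc)
  also have "\<dots> \<le> ennreal (l powr ?e) * (\<integral>\<^sup>+x. ennreal (F x powr p) \<partial>lborel)
      + ennreal ((1 - l) powr ?e) * (\<integral>\<^sup>+x. ennreal (G x powr p) \<partial>lborel)"
    by (intro add_mono mult_left_mono HF HG) auto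
  also have "\<dots> = (\<integral>\<^sup>+x. ennreal (l powr ?e) * ennreal (F x powr p)
      + ennreal ((1 - l) powr ?e) * ennreal (G x powr p) \<partial>lborel)"
    by (simp add: nn_integral_add nn_integral_cmult)
  also have "\<dots> \<le> (\<integral>\<^sup>+x. ennreal (norm (magnetic_grad (AB_potential \<alpha>) u x) powr p) \<partial>lborel)"
  proof (rule nn_integral_mono)
    fix x :: "real^2"
    let ?w = "magnetic_grad (AB_potential \<alpha>) u x"
    have "l powr ?e * F x powr p + (1 - l) powr ?e * G x powr p \<le> norm ?w powr p"
    \<comment> \<open>At the origin \<open>F\<close> and \<open>G\<close> are 0 by division by zero,
      so the left side vanishes.\<close>
    proof (cases "x = 0")
      case False
      have "l powr ?e * F x powr p + (1 - l) powr ?e * G x powr p \<le> ((F x)\<^sup>2 + (G x)\<^sup>2) powr (p / 2)"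
        using l assms(1,2) by (intro sum_squares_powr_ge) (auto simp: F_def G_def)
      also have "\<dots> = ((norm ?w)\<^sup>2) powr (p / 2)"
        unfolding norm_magnetic_grad_AB[OF False] F_def G_def ..
      also have "\<dots> = norm ?w powr p"
        using powr_powr[of "norm ?w" 2 "p/2"] by (cases "?w = 0") (auto simp: powr_numeral)
      finally show ?thesis .
    qed (simp add: F_def G_def)
    then show "ennreal (l powr ?e) * ennreal (F x powr p) + ennreal ((1 - l) powr ?e) * ennreal (G x powr p)
        \<le> ennreal (norm ?w powr p)"
      by (simp add: ennreal_mult'[symmetric] ennreal_plus[symmetric] ennreal_leI del: ennreal_plus)
  qed
  finally show ?thesis
    unfolding H_def S_def A_def K2 by (simp add: powr_divide)
qed

end
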